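(* Let $p(g\mid\mathbf w)=\sum_{k\in\mathcal A}\theta_kP_{(k)}(w_{-k},g)$ be an imitation kernel on a finite set $G$ with $\gcd(\mathcal A)=1$. If the $G$-stochastic function $P_{(\cdot)}$ is irreducible but its common period $\hat d$ satisfies $\hat d>1$, then $|\mathcal G(p)|>1$.
   Context: $\mathcal A\subset\mathbb N_+$, $\theta$ a probability on $\mathcal A$ with $\theta_k>0$ for $k\in\mathcal A$, $P_{(k)}$ stochastic matrices on $G$, $\mathbf w=(w_{-1},w_{-2},\dots)$. Compatibility: a law of $(X_n)_{n\in\mathbb Z}$ on $G^{\mathbb Z}$ is compatible with $p$ if $P(X_n=g\mid X_{n-1},X_{n-2},\dots)=p(g\mid X_{n-1},X_{n-2},\dots)$ a.s. for all $n,g$; $\mathcal G(p)$ is the set of compatible laws. Words $\mathcal A^*=\bigcup_{n\ge1}\mathcal A^n$, $P_{\mathbf a}=P_{(a_n)}\cdots P_{(a_1)}$, depth $s(\mathbf a)=\sum a_i$. Irreducible: for all $i,j$ some word has $P_{\mathbf a}(i,j)>0$. Period of $i$: $d_i=\gcd\{s(\mathbf a):P_{\mathbf a}(i,i)>0\}$; under irreducibility and $\gcd(\mathcal A)=1$ all $d_i$ equal a common value $\hat d$. *)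

theory Defs
  imports "HOL-Probability.Probability"
begin

text \<open>A past configuration w = (w_{-1}, w_{-2}, ...) is encoded as w :: nat => 'g
  with w k = w_{-k} for k >= 1 (w 0 is unused).\<close>

definition imitation_kernel ::
  "nat set \<Rightarrow> (nat \<Rightarrow> real) \<Rightarrow> (nat \<Rightarrow> 'g \<Rightarrow> 'g \<Rightarrow> real) \<Rightarrow> 'g \<Rightarrow> (nat \<Rightarrow> 'g) \<Rightarrow> real" where
  "imitation_kernel A \<theta> P g w = (\<Sum>\<^sub>\<infinity>k\<in>A. \<theta> k * P k (w k) g)"

definition stochastic_matrix :: "('g::finite \<Rightarrow> 'g \<Rightarrow> real) \<Rightarrow> bool" where
  "stochastic_matrix Q \<longleftrightarrow> (\<forall>i j. 0 \<le> Q i j) \<and> (\<forall>i. (\<Sum>j\<in>UNIV. Q i j) = 1)"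

definition mat_mult :: "('g::finite \<Rightarrow> 'g \<Rightarrow> real) \<Rightarrow> ('g \<Rightarrow> 'g \<Rightarrow> real) \<Rightarrow> 'g \<Rightarrow> 'g \<Rightarrow> real" where
  "mat_mult M N i j = (\<Sum>l\<in>UNIV. M i l * N l j)"

fun word_mat :: "(nat \<Rightarrow> 'g::finite \<Rightarrow> 'g \<Rightarrow> real) \<Rightarrow> nat list \<Rightarrow> 'g \<Rightarrow> 'g \<Rightarrow> real" where
  "word_mat P [] = (\<lambda>i j. if i = j then 1 else 0)"
| "word_mat P (a # as) = mat_mult (word_mat P as) (P a)"

definition words :: "nat set \<Rightarrow> nat list set" where
  "words A = {as. as \<noteq> [] \<and> set as \<subseteq> A}"

definition depth :: "nat list \<Rightarrow> nat" where
  "depth as = sum_list as"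

definition irreducible_fam :: "nat set \<Rightarrow> (nat \<Rightarrow> 'g::finite \<Rightarrow> 'g \<Rightarrow> real) \<Rightarrow> bool" where
  "irreducible_fam A P \<longleftrightarrow> (\<forall>i j. \<exists>as\<in>words A. word_mat P as i j > 0)"

definition period :: "nat set \<Rightarrow> (nat \<Rightarrow> 'g::finite \<Rightarrow> 'g \<Rightarrow> real) \<Rightarrow> 'g \<Rightarrow> nat" where
  "period A P i = Gcd {depth as | as. as \<in> words A \<and> word_mat P as i i > 0}"

definition path_space :: "(int \<Rightarrow> 'g) measure" where
  "path_space = PiM UNIV (\<lambda>_. count_space UNIV)"

definition past_algebra :: "int \<Rightarrow> (int \<Rightarrow> 'g) measure" where
  "past_algebra n = vimage_algebra (space path_space) (\<lambda>x. restrict x {..<n})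
      (PiM {..<n} (\<lambda>_. count_space UNIV))"

definition compatible :: "('g \<Rightarrow> (nat \<Rightarrow> 'g) \<Rightarrow> real) \<Rightarrow> (int \<Rightarrow> 'g) measure \<Rightarrow> bool" where
  "compatible p M \<longleftrightarrow> prob_space M \<and> sets M = sets path_space \<and>
     (\<forall>n g. AE x in M. real_cond_exp M (past_algebra n) (indicator {y\<in>space M. y n = g}) x
                         = p g (\<lambda>j. x (n - int j)))"

definition compatible_laws :: "('g \<Rightarrow> (nat \<Rightarrow> 'g) \<Rightarrow> real) \<Rightarrow> (int \<Rightarrow> 'g) measure set" where
  "compatible_laws p = {M. compatible p M}"

end

theory Submission
  imports Defs "HOL-Complex_Analysis.Great_Picard" "HOL-Number_Theory.Cong"
begin

text \<open>Fixing a base point, the depth modulo \<open>d\<close> of a word leading to \<open>j\<close> depends only on \<open>j\<close>; this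
  gives a phase \<open>c j\<close> which a transition of \<open>P k\<close> increases by \<open>k\<close>. Hence, for each \<open>r\<close>, the
  paths with \<open>c (x n) = n + r\<close> modulo \<open>d\<close> for all \<open>n\<close> are preserved by the kernel, and since
  the \<open>gcd\<close> of the lags is 1 every phase occurs, so that such paths exist. The kernel is continuous,
  because the tails of \<open>\<theta>\<close> bound the influence of the remote past; running it forward from time
  \<open>-N\<close> on a deterministic past with offset \<open>r\<close> and passing to a weak limit (\<open>'g\<close> is finite, so path
  space is compact) yields a compatible law with offset \<open>r\<close>. The laws for \<open>r = 0\<close> and
  \<open>r = 1\<close> live on disjoint sets of paths.\<close>

subsection \<open>Weak limits on product spaces over a finite alphabet\<close>

text \<open>For finite \<open>J\<close> over a finite alphabet these are the cylinder functions, the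
  test functions of the weak limits below. Infinite \<open>J\<close>, such as all times before
  \<open>n\<close>, expresses dependence on the past alone.\<close>

definition determined_by :: "'i set \<Rightarrow> (('i \<Rightarrow> 'g) \<Rightarrow> 'b) \<Rightarrow> bool" where
  "determined_by J f \<longleftrightarrow> (\<forall>x y. (\<forall>j\<in>J. x j = y j) \<longrightarrow> f x = f y)"

lemma determined_byD: "determined_by J f \<Longrightarrow> (\<And>j. j \<in> J \<Longrightarrow> x j = y j) \<Longrightarrow> f x = f y"
  unfolding determined_by_def by blast

lemma determined_by_mono: "determined_by J f \<Longrightarrow> J \<subseteq> K \<Longrightarrow> determined_by K f"
  unfolding determined_by_def by blast

text \<open>\<open>f\<close> factors through the restriction to \<open>J\<close>, which takes
  finitely many values and has measurable fibres.\<close>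

lemma borel_measurable_determined_by:
  fixes f :: "('i \<Rightarrow> 'g::finite) \<Rightarrow> real"
  assumes J: "finite J" "J \<subseteq> I" and f: "determined_by J f"
  shows "f \<in> borel_measurable (PiM I (\<lambda>_. count_space UNIV))"
proof -
  let ?X = "PiM I (\<lambda>_. count_space UNIV) :: ('i \<Rightarrow> 'g) measure"
  have "(\<lambda>x. restrict x J) \<in> measurable ?X (count_space (PiE J (\<lambda>_. UNIV)))"
  proof (subst measurable_count_space_eq2)
    show "finite (PiE J (\<lambda>_. UNIV :: 'g set))" by (intro finite_PiE J) auto
    have "(\<lambda>x. restrict x J) -` {u} \<inter> space ?X \<in> sets ?X" if "u \<in> PiE J (\<lambda>_. UNIV)" for u
    proof -
      have "(\<lambda>x. restrict x J) -` {u} \<inter> space ?X = {x\<in>space ?X. \<forall>j\<in>J. x j = u j}"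
        using that by (auto simp: fun_eq_iff restrict_def PiE_def extensional_def)
      moreover have "{x\<in>space ?X. \<forall>j\<in>J. x j = u j} \<in> sets ?X"
      proof (intro sets.sets_Collect_finite_All J)
        fix j assume "j \<in> J"
        then have [measurable]: "(\<lambda>x. x j) \<in> measurable ?X (count_space UNIV)"
          using J by (intro measurable_component_singleton) auto
        show "{x\<in>space ?X. x j = u j} \<in> sets ?X" by measurable
      qed
      ultimately show ?thesis by simp
    qed
    then show "(\<lambda>x. restrict x J) \<in> space ?X \<rightarrow> PiE J (\<lambda>_. UNIV) \<and>
       (\<forall>u\<in>PiE J (\<lambda>_. UNIV). (\<lambda>x. restrict x J) -` {u} \<inter> space ?X \<in> sets ?X)"
      by auto
  qed
  from measurable_compose[OF this, of f borel]
  have "(\<lambda>x. f (restrict x J)) \<in> borel_measurable ?X" by simp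
  also have "(\<lambda>x. f (restrict x J)) = f" by (intro ext determined_byD[OF f]) auto
  finally show ?thesis .
qed

text \<open>There are only countably many pairs of a finite \<open>J\<close> and a word
  \<open>u\<close> on \<open>J\<close>, so a diagonal subsequence makes all cylinder probabilities
  converge. Each \<open>J\<close> carries finitely many words, hence no mass is lost and the limits
  are again probabilities.\<close>

lemma pmf_cylinder_limit:
  fixes \<nu> :: "nat \<Rightarrow> ('i::countable \<Rightarrow> 'g::finite) pmf"
  obtains r q where "strict_mono (r :: nat \<Rightarrow> nat)"
    "\<And>J u. finite J \<Longrightarrow> (\<lambda>N. pmf (map_pmf (\<lambda>x. restrict x J) (\<nu> (r N))) u) \<longlonglongrightarrow> pmf (q J) u"
    "\<And>J. finite J \<Longrightarrow> set_pmf (q J) \<subseteq> PiE J (\<lambda>_. UNIV)"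
proof -
  define F where "F N = (\<lambda>(J, u). pmf (map_pmf (\<lambda>x. restrict x J) (\<nu> N)) u)" for N
  \<comment> \<open>Only words that are \<open>undefined\<close> outside \<open>J\<close> are
    listed, which keeps \<open>S\<close> countable; on every other \<open>u\<close> the
    probabilities are constantly 0.\<close>
  define S :: "('i set \<times> ('i \<Rightarrow> 'g)) set" where "S = (SIGMA J:{J. finite J}. PiE J (\<lambda>_. UNIV))"
  have fin: "finite (PiE J (\<lambda>_. UNIV :: 'g set))" if "finite J" for J :: "'i set"
    using that by (intro finite_PiE) auto
  have "countable S"
    unfolding S_def by (intro countable_SIGMA countable_Collect_finite countable_finite fin) auto
  then obtain r :: "nat \<Rightarrow> nat" where r: "strict_mono r"
    and conv: "\<And>s. s \<in> S \<Longrightarrow> \<exists>l. (\<lambda>N. F (r N) s) \<longlonglongrightarrow> l"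
    by (rule function_convergent_subsequence[of S F 1]) (auto simp: F_def pmf_le_1)
  define l where "l J u = lim (\<lambda>N. pmf (map_pmf (\<lambda>x. restrict x J) (\<nu> (r N))) u)" for J u
  have zero: "pmf (map_pmf (\<lambda>x. restrict x J) (\<nu> N)) u = 0" if "u \<notin> PiE J (\<lambda>_. UNIV)" for J N u
    using that by (auto simp: pmf_eq_0_set_pmf)
  have lim: "(\<lambda>N. pmf (map_pmf (\<lambda>x. restrict x J) (\<nu> (r N))) u) \<longlonglongrightarrow> l J u" if "finite J" for J u
  proof (cases "u \<in> PiE J (\<lambda>_. UNIV)")
    case True
    then have "\<exists>l. (\<lambda>N. F (r N) (J, u)) \<longlonglongrightarrow> l"
      using that by (intro conv) (auto simp: S_def)
    then show ?thesis
      unfolding l_def F_def using convergent_LIMSEQ_iff convergent_def by fastforce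
  qed (simp add: l_def zero)
  have l_nonneg: "0 \<le> l J u" if "finite J" for J u
    using lim[OF that] by (rule LIMSEQ_le_const) simp
  have l_zero: "l J u = 0" if "u \<notin> PiE J (\<lambda>_. UNIV)" for J u
    using that by (simp add: l_def zero)
  \<comment> \<open>The sum is finite, so it commutes with the limit.\<close>
  have l_sum: "(\<Sum>u\<in>PiE J (\<lambda>_. UNIV). l J u) = 1" if J: "finite J" for J
  proof -
    have "(\<lambda>N. \<Sum>u\<in>PiE J (\<lambda>_. UNIV). pmf (map_pmf (\<lambda>x. restrict x J) (\<nu> (r N))) u)
        \<longlonglongrightarrow> (\<Sum>u\<in>PiE J (\<lambda>_. UNIV). l J u)"
      by (intro tendsto_sum lim J)
    moreover have "(\<Sum>u\<in>PiE J (\<lambda>_. UNIV). pmf (map_pmf (\<lambda>x. restrict x J) (\<nu> N)) u) = 1" for N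
      by (intro sum_pmf_eq_1 fin J) auto
    ultimately show ?thesis by (simp add: LIMSEQ_const_iff)
  qed
  have "(\<integral>\<^sup>+u. ennreal (l J u) \<partial>count_space UNIV) = 1" if J: "finite J" for J
  proof -
    have "(\<integral>\<^sup>+u. ennreal (l J u) \<partial>count_space UNIV) = (\<Sum>u\<in>PiE J (\<lambda>_. UNIV). ennreal (l J u))"
      using l_zero by (intro nn_integral_count_space'[OF fin[OF J]]) auto
    then show ?thesis using l_sum[OF J] by (simp add: sum_ennreal l_nonneg J)
  qed
  then have pmf: "pmf (embed_pmf (l J)) u = l J u" if "finite J" for J u
    using that l_nonneg by (intro pmf_embed_pmf) auto
  show thesis
  proof
    show "(\<lambda>N. pmf (map_pmf (\<lambda>x. restrict x J) (\<nu> (r N))) u) \<longlonglongrightarrow> pmf (embed_pmf (l J)) u"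
      if "finite J" for J u using lim that by (simp add: pmf)
    show "set_pmf (embed_pmf (l J)) \<subseteq> PiE J (\<lambda>_. UNIV)" if "finite J" for J
      using pmf[OF that] l_zero[of _ J] unfolding set_pmf_eq by fastforce
  qed (fact r)
qed

lemma measurable_component_discrete:
  "(\<lambda>u. \<lambda>j\<in>J. discrete (u j)) \<in> measurable (measure_pmf q) (PiM J (\<lambda>_. borel))"
  by (auto simp: measurable_def space_PiM)

text \<open>Compactness of path space: the limits on finite index sets are consistent, and
  Kolmogorov's extension theorem glues them into one measure.\<close>

lemma pmf_weak_limit:
  fixes \<nu> :: "nat \<Rightarrow> ('i::countable \<Rightarrow> 'g::finite) pmf"
  obtains M r where "strict_mono (r :: nat \<Rightarrow> nat)" "prob_space M"
    "sets M = sets (PiM UNIV (\<lambda>_. count_space UNIV))"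
    "\<And>J (f :: _ \<Rightarrow> real). finite J \<Longrightarrow> determined_by J f \<Longrightarrow>
       (\<lambda>N. measure_pmf.expectation (\<nu> (r N)) f) \<longlonglongrightarrow> integral\<^sup>L M f"
proof -
  obtain r q where r: "strict_mono (r :: nat \<Rightarrow> nat)"
    and lim: "\<And>J u. finite J \<Longrightarrow>
      (\<lambda>N. pmf (map_pmf (\<lambda>x. restrict x J) (\<nu> (r N))) u) \<longlonglongrightarrow> pmf (q J) u"
    and supp: "\<And>J. finite J \<Longrightarrow> set_pmf (q J) \<subseteq> PiE J (\<lambda>_. UNIV)"
    by (rule pmf_cylinder_limit[of \<nu>]) blast
  have fin: "finite (PiE J (\<lambda>_. UNIV :: 'g set))" if "finite J" for J :: "'i set"
    using that by (intro finite_PiE) auto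
  have expect: "(\<lambda>N. measure_pmf.expectation (\<nu> (r N)) f) \<longlonglongrightarrow> measure_pmf.expectation (q J) f"
    if J: "finite J" and f: "determined_by J f" for J and f :: "('i \<Rightarrow> 'g) \<Rightarrow> real"
  proof -
    have "measure_pmf.expectation (\<nu> N) f
        = (\<Sum>u\<in>PiE J (\<lambda>_. UNIV). f u * pmf (map_pmf (\<lambda>x. restrict x J) (\<nu> N)) u)" for N
    proof -
      have "measure_pmf.expectation (\<nu> N) f
          = measure_pmf.expectation (map_pmf (\<lambda>x. restrict x J) (\<nu> N)) f"
        by (auto intro!: Bochner_Integration.integral_cong determined_byD[OF f])
      also have "\<dots> = (\<Sum>u\<in>PiE J (\<lambda>_. UNIV). f u * pmf (map_pmf (\<lambda>x. restrict x J) (\<nu> N)) u)"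
        by (rule integral_measure_pmf_real[OF fin[OF J]]) auto
      finally show ?thesis .
    qed
    moreover have "measure_pmf.expectation (q J) f = (\<Sum>u\<in>PiE J (\<lambda>_. UNIV). f u * pmf (q J) u)"
      using supp[OF J] by (intro integral_measure_pmf_real[OF fin[OF J]]) auto
    ultimately show ?thesis by (auto intro!: tendsto_sum tendsto_mult lim J)
  qed
  \<comment> \<open>A cylinder over \<open>J\<close> is also one over \<open>H\<close>, so its
    probability converges to both sides; limits are unique.\<close>
  have consistent: "q J = map_pmf (\<lambda>x. restrict x J) (q H)" if JH: "J \<subseteq> H" "finite H" for J H
  proof (rule pmf_eqI)
    fix u :: "'i \<Rightarrow> 'g"
    have J: "finite J" using JH finite_subset by blast
    let ?f = "indicator ((\<lambda>x. restrict x J) -` {u}) :: _ \<Rightarrow> real"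
    have "determined_by H ?f"
      using JH unfolding determined_by_def
      by (auto simp: indicator_def fun_eq_iff restrict_def split: if_splits) (metis subsetD)+
    from expect[OF JH(2) this]
    have "(\<lambda>N. pmf (map_pmf (\<lambda>x. restrict x J) (\<nu> (r N))) u) \<longlonglongrightarrow> pmf (map_pmf (\<lambda>x. restrict x J) (q H)) u"
      by (simp add: pmf_map)
    with lim[OF J] show "pmf (q J) u = pmf (map_pmf (\<lambda>x. restrict x J) (q H)) u"
      by (rule LIMSEQ_unique)
  qed
  \<comment> \<open>\<open>polish_projective\<close> asks for Borel sets of a Polish space, so the
    letters are wrapped in \<open>discrete\<close>, which carries the discrete topology.\<close>
  define P where "P J = distr (measure_pmf (q J)) (PiM J (\<lambda>_. borel)) (\<lambda>u. \<lambda>j\<in>J. discrete (u j))" for J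
  interpret polish_projective UNIV P
  proof (intro polish_projective.intro projective_family.intro)
    fix J H :: "'i set" assume JH: "J \<subseteq> H" "finite H"
    have [measurable]: "(\<lambda>f. restrict f J) \<in> measurable (PiM H (\<lambda>_. borel :: 'g discrete measure)) (PiM J (\<lambda>_. borel))"
      using JH by (intro measurable_restrict_subset)
    have "distr (P H) (PiM J (\<lambda>_. borel)) (\<lambda>f. restrict f J)
        = distr (measure_pmf (q H)) (PiM J (\<lambda>_. borel)) ((\<lambda>f. restrict f J) \<circ> (\<lambda>u. \<lambda>j\<in>H. discrete (u j)))"
      unfolding P_def by (intro distr_distr measurable_component_discrete) measurable
    also have "(\<lambda>f. restrict f J) \<circ> (\<lambda>u. \<lambda>j\<in>H. discrete (u j))
        = (\<lambda>u. \<lambda>j\<in>J. discrete (u j)) \<circ> (\<lambda>x :: 'i \<Rightarrow> 'g. restrict x J)"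
      using JH by (auto simp: fun_eq_iff restrict_def)
    also have "distr (measure_pmf (q H)) (PiM J (\<lambda>_. borel)) \<dots>
        = distr (distr (measure_pmf (q H)) (count_space UNIV) (\<lambda>x. restrict x J))
            (PiM J (\<lambda>_. borel)) (\<lambda>u. \<lambda>j\<in>J. discrete (u j))"
      by (intro distr_distr[symmetric]) (auto simp: measurable_def space_PiM)
    also have "\<dots> = P J"
      unfolding P_def consistent[OF JH] map_pmf_rep_eq ..
    finally show "P J = distr (P H) (PiM J (\<lambda>_. borel)) (\<lambda>f. restrict f J)" ..
  next
    show "prob_space (P J)" for J :: "'i set"
      unfolding P_def by (intro measure_pmf.prob_space_distr measurable_component_discrete)
  qed
  have distr_lim: "distr lim (PiM J (\<lambda>_. borel)) (\<lambda>x. restrict x J) = P J" if J: "finite J" for J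
  proof (rule measure_eqI)
    show "sets (distr lim (PiM J (\<lambda>_. borel)) (\<lambda>x. restrict x J)) = sets (P J)"
      by (simp add: P_def)
    fix X assume "X \<in> sets (distr lim (PiM J (\<lambda>_. borel)) (\<lambda>x. restrict x J))"
    then have X: "X \<in> sets (PiM J (\<lambda>_. borel))" by simp
    have [measurable]: "(\<lambda>f. restrict f J) \<in> measurable (PiM UNIV (\<lambda>_. borel :: 'g discrete measure)) (PiM J (\<lambda>_. borel))"
      by (intro measurable_restrict_subset) auto
    have "emeasure (distr lim (PiM J (\<lambda>_. borel)) (\<lambda>x. restrict x J)) X = emeasure lim (emb UNIV J X)"
      using X by (subst emeasure_distr) (auto simp: prod_emb_def space_PiM cong: measurable_cong_sets)
    also have "\<dots> = emeasure (P J) X" by (rule emeasure_lim_emb[OF _ J X]) simp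
    finally show "emeasure (distr lim (PiM J (\<lambda>_. borel)) (\<lambda>x. restrict x J)) X = emeasure (P J) X" .
  qed
  let ?X = "PiM UNIV (\<lambda>_. count_space UNIV) :: ('i \<Rightarrow> 'g) measure"
  \<comment> \<open>\<open>D\<close> removes the wrapper again; the image of \<open>lim\<close>
    under \<open>D\<close> is the measure sought.\<close>
  define D where "D x = (\<lambda>i. of_discrete (x i))" for x :: "'i \<Rightarrow> 'g discrete"
  have od: "of_discrete \<in> measurable borel (count_space (UNIV :: 'g set))"
    by (auto simp: measurable_def intro!: borel_open open_discrete)
  have D: "D \<in> measurable lim ?X"
    unfolding D_def measurable_cong_sets[OF sets_lim refl]
    by (intro measurable_PiM_single' measurable_compose[OF _ od] measurable_component_singleton) auto
  have "integral\<^sup>L (distr lim ?X D) f = measure_pmf.expectation (q J) f"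
    if J: "finite J" and f: "determined_by J f" for J and f :: "('i \<Rightarrow> 'g) \<Rightarrow> real"
  proof -
    \<comment> \<open>\<open>E\<close> does the same for points known on \<open>J\<close> only. The
      value chosen elsewhere is arbitrary, since \<open>f\<close> reads nothing outside
      \<open>J\<close>.\<close>
    define E :: "('i \<Rightarrow> 'g discrete) \<Rightarrow> 'i \<Rightarrow> 'g"
      where "E y = (\<lambda>i. if i \<in> J then of_discrete (y i) else undefined)" for y
    have E: "E \<in> measurable (PiM J (\<lambda>_. borel)) ?X"
      unfolding E_def
    proof (intro measurable_PiM_single')
      fix i
      show "(\<lambda>y. if i \<in> J then of_discrete (y i) else undefined)
          \<in> measurable (PiM J (\<lambda>_. borel)) (count_space (UNIV :: 'g set))"
      proof (cases "i \<in> J")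
        case True
        then have "(\<lambda>y. y i) \<in> measurable (PiM J (\<lambda>_. borel)) (borel :: 'g discrete measure)"
          by (rule measurable_component_singleton)
        from measurable_compose[OF this od] True show ?thesis by simp
      qed simp
    qed auto
    note fm = borel_measurable_determined_by[OF J subset_UNIV f]
    have rm: "(\<lambda>x. restrict x J) \<in> measurable lim (PiM J (\<lambda>_. borel))"
      unfolding measurable_cong_sets[OF sets_lim refl] by (intro measurable_restrict_subset) auto
    have fE: "(\<lambda>y. f (E y)) \<in> borel_measurable (PiM J (\<lambda>_. borel))"
      by (rule measurable_compose[OF E fm])
    have "integral\<^sup>L (distr lim ?X D) f = (\<integral>x. f (D x) \<partial>lim)"
      by (rule integral_distr[OF D fm])
    also have "\<dots> = (\<integral>x. f (E (restrict x J)) \<partial>lim)"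
      by (intro Bochner_Integration.integral_cong refl determined_byD[OF f]) (simp add: D_def E_def)
    also have "\<dots> = (\<integral>y. f (E y) \<partial>P J)"
      unfolding distr_lim[OF J, symmetric] by (rule integral_distr[OF rm fE, symmetric])
    also have "\<dots> = measure_pmf.expectation (q J) (\<lambda>u. f (E (\<lambda>j\<in>J. discrete (u j))))"
      unfolding P_def by (rule integral_distr[OF measurable_component_discrete fE])
    also have "\<dots> = measure_pmf.expectation (q J) f"
      by (intro Bochner_Integration.integral_cong refl determined_byD[OF f]) (simp add: E_def discrete_inverse)
    finally show ?thesis .
  qed
  with expect r P.prob_space_distr[OF D] show thesis by (intro that[of r "distr lim ?X D"]) auto
qed

subsection \<open>Continuous kernels\<close>

text \<open>Slot 0 holds \<open>x n\<close>, the very letter that is predicted from the past.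
  Continuous kernels never read it, by \<open>kernel_cong\<close>.\<close>

definition past :: "(int \<Rightarrow> 'g) \<Rightarrow> int \<Rightarrow> nat \<Rightarrow> 'g" where
  "past x n = (\<lambda>k. x (n - int k))"

text \<open>The last condition is continuity in the product topology, in its uniform form:
  \<open>m\<close> depends on \<epsilon> only. The lags start at 1, so slot 0 has no
  influence.\<close>

locale continuous_kernel =
  fixes p :: "'g::finite \<Rightarrow> (nat \<Rightarrow> 'g) \<Rightarrow> real"
  assumes nonneg: "0 \<le> p g w"
    and sum_one: "(\<Sum>g\<in>UNIV. p g w) = 1"
    and continuity: "\<epsilon> > 0 \<Longrightarrow>
      \<exists>m. \<forall>g w w'. (\<forall>k\<in>{1..m}. w k = w' k) \<longrightarrow> \<bar>p g w - p g w'\<bar> < \<epsilon>"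
begin

text \<open>Such pasts agree up to every \<open>m\<close>, so continuity with the gap itself as
  \<epsilon> makes the gap smaller than itself.\<close>

lemma kernel_cong:
  assumes "\<And>k. k \<ge> 1 \<Longrightarrow> w k = w' k"
  shows "p g w = p g w'"
proof (rule ccontr)
  assume "p g w \<noteq> p g w'"
  then have "\<bar>p g w - p g w'\<bar> > 0" by simp
  from continuity[OF this] obtain m where
    "(\<forall>k\<in>{1..m}. w k = w' k) \<longrightarrow> \<bar>p g w - p g w'\<bar> < \<bar>p g w - p g w'\<bar>"
    by blast
  with assms show False by simp
qed

lemma kernel_le_one: "p g w \<le> 1"
  using member_le_sum[of g UNIV "\<lambda>g. p g w"] nonneg sum_one[of w] by simp

section \<open>Running the kernel forward for finitely many steps\<close>

definition step :: "(nat \<Rightarrow> 'g) \<Rightarrow> 'g pmf" where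
  "step w = embed_pmf (\<lambda>g. p g w)"

lemma pmf_step: "pmf (step w) g = p g w"
  unfolding step_def
proof (rule pmf_embed_pmf)
  have "(\<integral>\<^sup>+g. ennreal (p g w) \<partial>count_space UNIV) = (\<Sum>g\<in>UNIV. ennreal (p g w))"
    by (rule nn_integral_count_space_finite) simp
  then show "(\<integral>\<^sup>+g. ennreal (p g w) \<partial>count_space UNIV) = 1"
    by (simp add: sum_ennreal nonneg sum_one)
qed (rule nonneg)

text \<open>Coordinates \<open>s\<close> to \<open>s + t - 1\<close> are drawn one after the other;
  all others, the future ones included, keep their value from \<open>z\<close>. Thus the law has
  finite support.\<close>

primrec run :: "(int \<Rightarrow> 'g) \<Rightarrow> int \<Rightarrow> nat \<Rightarrow> (int \<Rightarrow> 'g) pmf" where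
  "run z s 0 = return_pmf z"
| "run z s (Suc t) = bind_pmf (run z s t)
    (\<lambda>x. map_pmf (\<lambda>g. x(s + int t := g)) (step (past x (s + int t))))"

lemma finite_set_run: "finite (set_pmf (run z s t))"
  by (induction t) auto

lemma expectation_run_Suc:
  fixes f :: "(int \<Rightarrow> 'g) \<Rightarrow> real"
  shows "measure_pmf.expectation (run z s (Suc t)) f = measure_pmf.expectation (run z s t)
    (\<lambda>x. \<Sum>g\<in>UNIV. p g (past x (s + int t)) * f (x(s + int t := g)))"
proof -
  have "measure_pmf.expectation (run z s (Suc t)) f
      = (\<Sum>x\<in>set_pmf (run z s t). pmf (run z s t) x *\<^sub>R
          measure_pmf.expectation (map_pmf (\<lambda>g. x(s + int t := g)) (step (past x (s + int t)))) f)"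
    unfolding run.simps by (rule pmf_expectation_bind) (auto simp: finite_set_run)
  also have "\<dots> = (\<Sum>x\<in>set_pmf (run z s t).
      (\<Sum>g\<in>UNIV. p g (past x (s + int t)) * f (x(s + int t := g))) * pmf (run z s t) x)"
    by (intro sum.cong refl)
      (simp add: integral_measure_pmf_real[of UNIV] pmf_step mult.commute)
  also have "\<dots> = measure_pmf.expectation (run z s t)
      (\<lambda>x. \<Sum>g\<in>UNIV. p g (past x (s + int t)) * f (x(s + int t := g)))"
    by (rule integral_measure_pmf_real[symmetric]) (auto simp: finite_set_run)
  finally show ?thesis .
qed

text \<open>Later steps overwrite only coordinates from \<open>s + t\<close> on, which
  \<open>f\<close> does not read.\<close>

lemma expectation_run_determined_by:
  fixes f :: "(int \<Rightarrow> 'g) \<Rightarrow> real"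
  assumes f: "determined_by {..<s + int t} f"
  shows "measure_pmf.expectation (run z s (t + u)) f = measure_pmf.expectation (run z s t) f"
proof (induction u)
  case (Suc u)
  have "f (x(s + int (t + u) := g)) = f x" for x g
    by (rule determined_byD[OF f]) auto
  then have "measure_pmf.expectation (run z s (Suc (t + u))) f = measure_pmf.expectation (run z s (t + u)) f"
    unfolding expectation_run_Suc by (simp flip: sum_distrib_right add: sum_one)
  with Suc show ?case by simp
qed simp

lemma past_upd: "p g (past (x(n := h)) n) = p g (past x n)"
  by (rule kernel_cong) (auto simp: past_def)

lemma determined_by_past: "determined_by {..<n} (\<lambda>x. p g (past x n))"
  unfolding determined_by_def by (auto intro!: kernel_cong simp: past_def)

text \<open>The identity behind compatibility is exact for a run that has already drawn the letter
  at \<open>n\<close>: later steps affect neither side, and averaging over this one draw gives the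
  kernel.\<close>

lemma expectation_run_kernel:
  fixes f :: "(int \<Rightarrow> 'g) \<Rightarrow> real"
  assumes f: "determined_by {..<n} f" and n: "s \<le> n" "n < s + int t"
  shows "measure_pmf.expectation (run z s t) (\<lambda>x. f x * indicator {g} (x n))
       = measure_pmf.expectation (run z s t) (\<lambda>x. f x * p g (past x n))"
proof -
  \<comment> \<open>\<open>t0\<close> steps precede the draw at time \<open>n\<close>, and
    \<open>u\<close> steps follow it.\<close>
  define t0 u where "t0 = nat (n - s)" and "u = t - Suc t0"
  have n_eq: "n = s + int t0" and t: "t = Suc t0 + u"
    using n by (auto simp: t0_def u_def)
  have f_upd: "f (x(n := h)) = f x" for x h
    by (rule determined_byD[OF f]) auto
  have det: "determined_by {..<s + int (Suc t0)} (\<lambda>x. f x * indicator {g} (x n))"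
    and det': "determined_by {..<s + int (Suc t0)} (\<lambda>x. f x * p g (past x n))"
    unfolding determined_by_def
    by (auto simp: n_eq intro!: arg_cong2[where f = "(*)"] determined_byD[OF f]
        determined_byD[OF determined_by_past])
  have "(\<Sum>h\<in>UNIV. p h (past x n) * (f x * indicator {g} h)) = f x * p g (past x n)" for x
    by (simp add: indicator_def of_bool_def if_distrib eq_commute[of _ g] cong: if_cong)
  moreover have "(\<Sum>h\<in>UNIV. p h (past x n) * (f x * p g (past x n))) = f x * p g (past x n)" for x
    by (simp add: sum_one flip: sum_distrib_right)
  ultimately have "measure_pmf.expectation (run z s (Suc t0)) (\<lambda>x. f x * indicator {g} (x n))
      = measure_pmf.expectation (run z s (Suc t0)) (\<lambda>x. f x * p g (past x n))"
    unfolding expectation_run_Suc by (simp add: f_upd past_upd flip: n_eq)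
  then show ?thesis
    unfolding t expectation_run_determined_by[OF det] expectation_run_determined_by[OF det'] .
qed

text \<open>By induction the whole path respects \<Phi>, so every past fed to the kernel is
  admissible, and a drawn letter has positive probability.\<close>

lemma run_invariant:
  assumes z: "\<And>n. z n \<in> \<Phi> n"
    and inv: "\<And>n w g. (\<And>k. k \<ge> 1 \<Longrightarrow> w k \<in> \<Phi> (n - int k)) \<Longrightarrow> p g w > 0 \<Longrightarrow> g \<in> \<Phi> n"
  shows "x \<in> set_pmf (run z s t) \<Longrightarrow> x n \<in> \<Phi> n"
proof (induction t arbitrary: x n)
  case (Suc t)
  then obtain y g where y: "y \<in> set_pmf (run z s t)" and g: "g \<in> set_pmf (step (past y (s + int t)))"
    and x: "x = y(s + int t := g)" by auto
  have "p g (past y (s + int t)) > 0"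
    using g by (simp add: set_pmf_eq pmf_step nonneg less_le)
  then have "g \<in> \<Phi> (s + int t)"
    by (rule inv[rotated]) (simp add: past_def Suc.IH[OF y])
  then show ?case using Suc.IH[OF y] by (auto simp: x)
qed (simp add: z)

text \<open>The value \<open>undefined\<close> beyond lag \<open>m\<close> is arbitrary: continuity makes it irrelevant up to \<open>\<epsilon>\<close>.\<close>

definition truncate :: "'g \<Rightarrow> int \<Rightarrow> nat \<Rightarrow> (int \<Rightarrow> 'g) \<Rightarrow> real" where
  "truncate g n m x = p g (\<lambda>k. if k \<in> {1..m} then x (n - int k) else undefined)"

lemma determined_by_truncate: "determined_by {n - int m..<n} (truncate g n m)"
  unfolding determined_by_def truncate_def by (auto intro!: kernel_cong)

lemma truncate_approx:
  assumes "\<epsilon> > 0"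
  obtains m where "\<And>x. \<bar>p g (past x n) - truncate g n m x\<bar> < \<epsilon>"
proof -
  obtain m where m: "\<And>g w w'. (\<forall>k\<in>{1..m}. w k = w' k) \<Longrightarrow> \<bar>p g w - p g w'\<bar> < \<epsilon>"
    using continuity[OF assms] by blast
  show thesis
    by (rule that[of m]) (auto simp: truncate_def past_def intro!: m)
qed

text \<open>The truncations are cylinder functions and converge uniformly to the kernel.
  \<open>I\<close> is all times for measurability on path space, and the times before
  \<open>n\<close> for measurability in the past.\<close>

lemma borel_measurable_past:
  assumes "{..<n} \<subseteq> I"
  shows "(\<lambda>x. p g (past x n)) \<in> borel_measurable (PiM I (\<lambda>_. count_space UNIV))"
proof -
  have "\<exists>m. \<forall>x. \<bar>p g (past x n) - truncate g n m x\<bar> < 1 / real (Suc i)" for i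
    by (rule truncate_approx[of "1 / real (Suc i)" g n]) auto
  then obtain m where m: "\<And>i x. \<bar>p g (past x n) - truncate g n (m i) x\<bar> < 1 / real (Suc i)"
    by metis
  show ?thesis
  proof (rule borel_measurable_LIMSEQ_real)
    show "truncate g n (m i) \<in> borel_measurable (PiM I (\<lambda>_. count_space UNIV))" for i
      using assms by (intro borel_measurable_determined_by[OF _ _ determined_by_truncate]) auto
    show "(\<lambda>i. truncate g n (m i) x) \<longlonglongrightarrow> p g (past x n)" for x
    proof (rule LIMSEQ_I)
      fix e :: real assume "e > 0"
      then obtain i0 where i0: "1 / real (Suc i0) < e"
        using reals_Archimedean[of e] by (auto simp: inverse_eq_divide)
      have "norm (truncate g n (m i) x - p g (past x n)) < e" if "i \<ge> i0" for i
      proof -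
        have "1 / real (Suc i) \<le> 1 / real (Suc i0)" using that by (intro divide_left_mono) auto
        with m[of x i] i0 show ?thesis by (simp add: abs_minus_commute)
      qed
      then show "\<exists>i0. \<forall>i\<ge>i0. norm (truncate g n (m i) x - p g (past x n)) < e" by blast
    qed
  qed
qed

text \<open>The kernel reads the whole past, so weak convergence does not apply to it directly. It
  is replaced by a truncation, first under the runs and then under \<open>M\<close>.\<close>

lemma integral_kernel_limit:
  fixes M :: "(int \<Rightarrow> 'g) measure" and f :: "(int \<Rightarrow> 'g) \<Rightarrow> real"
  assumes M: "prob_space M" "sets M = sets path_space" and r: "strict_mono (r :: nat \<Rightarrow> nat)"
    and lim: "\<And>J (f :: _ \<Rightarrow> real). finite J \<Longrightarrow> determined_by J f \<Longrightarrow>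
       (\<lambda>N. measure_pmf.expectation (run z (- int (r N)) (2 * r N)) f) \<longlonglongrightarrow> integral\<^sup>L M f"
    and J: "finite J" "J \<subseteq> {..<n}" and f: "determined_by J f" and f1: "\<And>x. \<bar>f x\<bar> \<le> 1"
  shows "(\<integral>x. f x * indicator {g} (x n) \<partial>M) = (\<integral>x. f x * p g (past x n) \<partial>M)"
proof -
  interpret prob_space M by fact
  have meas_M: "borel_measurable M = borel_measurable (PiM UNIV (\<lambda>_. count_space UNIV))"
    using M(2) by (intro measurable_cong_sets) (auto simp: path_space_def)
  let ?Q = "\<lambda>x. p g (past x n)" and ?I = "\<lambda>x. indicator {g} (x n) :: real"
  have [measurable]: "f \<in> borel_measurable M" "?Q \<in> borel_measurable M" "?I \<in> borel_measurable M"
    unfolding meas_M using J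
    by (auto intro!: borel_measurable_determined_by[OF _ _ f] borel_measurable_past
        borel_measurable_determined_by[of "{n}"] simp: determined_by_def)
  have prod_le: "\<bar>f x * a\<bar> \<le> b" if "\<bar>a\<bar> \<le> b" for x a b
    using mult_mono[OF f1[of x] that] by (simp add: abs_mult)
  \<comment> \<open>One \<epsilon> pays for the truncation under the runs, which survives in the
    limit, the other for the truncation under \<open>M\<close>.\<close>
  have "\<bar>(\<integral>x. f x * ?I x \<partial>M) - (\<integral>x. f x * ?Q x \<partial>M)\<bar> \<le> 2 * \<epsilon>" if \<epsilon>: "\<epsilon> > 0" for \<epsilon>
  proof -
    obtain m where m: "\<And>x. \<bar>?Q x - truncate g n m x\<bar> < \<epsilon>"
      using truncate_approx[OF \<epsilon>] by blast
    let ?T = "truncate g n m" and ?K = "J \<union> {n - int m..n}"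
    have [measurable]: "?T \<in> borel_measurable M"
      unfolding meas_M by (intro borel_measurable_determined_by[OF _ _ determined_by_truncate]) auto
    have T1: "\<bar>?T x\<bar> \<le> 1" for x
      by (simp add: truncate_def nonneg kernel_le_one)
    define h where "h x = f x * (?I x - ?T x)" for x
    have "determined_by ?K h"
      unfolding determined_by_def
    proof (intro allI impI)
      fix x y :: "int \<Rightarrow> 'g" assume "\<forall>j\<in>?K. x j = y j"
      then show "h x = h y"
        using determined_byD[OF f, of x y] determined_byD[OF determined_by_truncate, of n m x y g]
        by (simp add: h_def)
    qed
    with lim[of ?K h] J have h_lim:
      "(\<lambda>N. measure_pmf.expectation (run z (- int (r N)) (2 * r N)) h) \<longlonglongrightarrow> integral\<^sup>L M h"
      by simp
    have "\<bar>measure_pmf.expectation (run z (- int (r N)) (2 * r N)) h\<bar> \<le> \<epsilon>"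
      if N: "N \<ge> nat \<bar>n\<bar> + 1" for N
    proof -
      let ?R = "run z (- int (r N)) (2 * r N)"
      have int: "integrable (measure_pmf ?R) q" for q :: "_ \<Rightarrow> real"
        by (rule integrable_measure_pmf_finite[OF finite_set_run])
      \<comment> \<open>Hence \<open>r N\<close> exceeds the absolute value of \<open>n\<close>, and
        time \<open>n\<close> lies in the window of drawn coordinates.\<close>
      have "r N \<ge> N" by (rule seq_suble[OF r])
      then have n: "- int (r N) \<le> n" "n < - int (r N) + int (2 * r N)"
        using N by linarith+
      have "measure_pmf.expectation ?R h
          = measure_pmf.expectation ?R (\<lambda>x. f x * ?I x) - measure_pmf.expectation ?R (\<lambda>x. f x * ?T x)"
        unfolding h_def right_diff_distrib by (intro Bochner_Integration.integral_diff int)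
      \<comment> \<open>The exact identity for runs trades the indicator for the kernel, leaving
        only the truncation error.\<close>
      also have "\<dots> = measure_pmf.expectation ?R (\<lambda>x. f x * (?Q x - ?T x))"
        unfolding expectation_run_kernel[OF determined_by_mono[OF f J(2)] n]
          right_diff_distrib by (intro Bochner_Integration.integral_diff[symmetric] int)
      also have "\<bar>\<dots>\<bar> \<le> measure_pmf.expectation ?R (\<lambda>x. \<bar>f x * (?Q x - ?T x)\<bar>)"
        by (rule integral_abs_bound)
      also have "\<dots> \<le> \<epsilon>"
        using m by (intro measure_pmf.integral_le_const int AE_I2 prod_le less_imp_le)
      finally show ?thesis .
    qed
    then have "\<forall>\<^sub>F N in sequentially. \<bar>measure_pmf.expectation (run z (- int (r N)) (2 * r N)) h\<bar> \<le> \<epsilon>"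
      unfolding eventually_sequentially by blast
    with tendsto_rabs[OF h_lim] have "\<bar>integral\<^sup>L M h\<bar> \<le> \<epsilon>"
      by (rule tendsto_upperbound) simp
    moreover have int: "integrable M (\<lambda>x. f x * ?I x)" "integrable M (\<lambda>x. f x * ?Q x)"
        "integrable M (\<lambda>x. f x * ?T x)"
      using T1 by (auto intro!: integrable_const_bound[where B = 1] prod_le AE_I2
          simp: nonneg kernel_le_one)
    then have "integral\<^sup>L M h = (\<integral>x. f x * ?I x \<partial>M) - (\<integral>x. f x * ?T x \<partial>M)"
      unfolding h_def right_diff_distrib by (intro Bochner_Integration.integral_diff)
    moreover have "\<bar>(\<integral>x. f x * ?Q x \<partial>M) - (\<integral>x. f x * ?T x \<partial>M)\<bar> \<le> \<epsilon>"
    proof -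
      have "(\<integral>x. f x * ?Q x \<partial>M) - (\<integral>x. f x * ?T x \<partial>M) = (\<integral>x. f x * (?Q x - ?T x) \<partial>M)"
        unfolding right_diff_distrib using int by (intro Bochner_Integration.integral_diff[symmetric])
      also have "\<bar>\<dots>\<bar> \<le> (\<integral>x. \<bar>f x * (?Q x - ?T x)\<bar> \<partial>M)"
        by (rule integral_abs_bound)
      also have "\<dots> \<le> \<epsilon>"
      proof (rule integral_le_const)
        show "AE x in M. \<bar>f x * (?Q x - ?T x)\<bar> \<le> \<epsilon>"
          using m by (intro AE_I2 prod_le less_imp_le)
        then show "integrable M (\<lambda>x. \<bar>f x * (?Q x - ?T x)\<bar>)"
          by (intro integrable_const_bound[where B = \<epsilon>]) auto
      qed
      finally show ?thesis .
    qed
    ultimately show ?thesis by linarith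
  qed
  \<comment> \<open>With a quarter of the gap as \<epsilon>, a positive gap would be at most half of
    itself.\<close>
  from this[of "\<bar>(\<integral>x. f x * ?I x \<partial>M) - (\<integral>x. f x * ?Q x \<partial>M)\<bar> / 4"]
  show ?thesis by fastforce
qed

end

section \<open>From integral identities to compatible laws\<close>

lemma emeasure_density_indicator_integral:
  fixes u :: "'a \<Rightarrow> real"
  assumes M: "finite_measure M" and [measurable]: "u \<in> borel_measurable M" "C \<in> sets M"
    and u: "\<And>x. 0 \<le> u x" "\<And>x. u x \<le> 1"
  shows "emeasure (density M (\<lambda>x. ennreal (u x))) C = ennreal (\<integral>x. indicator C x * u x \<partial>M)"
proof -
  interpret finite_measure M by fact
  have "emeasure (density M (\<lambda>x. ennreal (u x))) C = (\<integral>\<^sup>+x. ennreal (indicator C x * u x) \<partial>M)"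
    by (subst emeasure_density) (auto intro!: nn_integral_cong simp: indicator_def)
  also have "\<dots> = ennreal (\<integral>x. indicator C x * u x \<partial>M)"
    using u by (intro nn_integral_eq_integral integrable_const_bound[where B = 1] AE_I2)
      (auto simp: indicator_def)
  finally show ?thesis .
qed

context continuous_kernel
begin

text \<open>Conditional probability needs the identity on every past event. Both sides, as functions
  of the event, are finite measures on the past, so agreement on cylinders, which are stable under
  intersection and generate the past, is enough.\<close>

lemma compatibleI:
  fixes M :: "(int \<Rightarrow> 'g) measure"
  assumes M: "prob_space M" "sets M = sets path_space"
    and eq: "\<And>n g J (f :: _ \<Rightarrow> real). finite J \<Longrightarrow> J \<subseteq> {..<n} \<Longrightarrow> determined_by J f \<Longrightarrow>
      (\<And>x. \<bar>f x\<bar> \<le> 1) \<Longrightarrow>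
      (\<integral>x. f x * indicator {g} (x n) \<partial>M) = (\<integral>x. f x * p g (past x n) \<partial>M)"
  shows "compatible p M"
proof -
  interpret prob_space M by fact
  have space_M: "space M = UNIV"
    using sets_eq_imp_space_eq[OF M(2)] by (simp add: path_space_def space_PiM)
  have "AE x in M. real_cond_exp M (past_algebra n) (indicator {y\<in>space M. y n = g}) x = p g (past x n)"
    for n g
  proof -
    let ?R = "PiM {..<n} (\<lambda>_. count_space UNIV) :: (int \<Rightarrow> 'g) measure"
    let ?res = "\<lambda>x :: int \<Rightarrow> 'g. restrict x {..<n}"
    let ?Q = "\<lambda>x. p g (past x n)" and ?I = "\<lambda>x. indicator {g} (x n) :: real"
    have res_path: "?res \<in> measurable path_space ?R"
      unfolding path_space_def by (intro measurable_restrict_subset) auto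
    then have res[measurable]: "?res \<in> measurable M ?R"
      by (simp cong: measurable_cong_sets add: M(2))
    have past_sets: "sets (past_algebra n :: (int \<Rightarrow> 'g) measure) = {?res -` B | B. B \<in> sets ?R}"
      unfolding past_algebra_def
      by (subst sets_vimage_algebra2) (auto simp: path_space_def space_PiM)
    interpret finite_measure_subalgebra M "past_algebra n"
    proof
      show "subalgebra M (past_algebra n)"
        unfolding subalgebra_def using measurable_sets[OF res]
        by (auto simp: past_sets space_M) (auto simp: past_algebra_def path_space_def space_PiM)
    qed
    have meas_M: "borel_measurable M = borel_measurable (PiM UNIV (\<lambda>_. count_space UNIV))"
      using M(2) by (intro measurable_cong_sets) (auto simp: path_space_def)
    have [measurable]: "?Q \<in> borel_measurable M" "?I \<in> borel_measurable M"
      unfolding meas_M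
      by (auto intro!: borel_measurable_past borel_measurable_determined_by[of "{n}"]
          simp: determined_by_def)
    have Q_past: "?Q \<in> borel_measurable (past_algebra n)"
    proof -
      \<comment> \<open>Restriction puts \<open>undefined\<close> into slot 0 of the past, which the
        kernel ignores.\<close>
      have "(\<lambda>x. p g (past (?res x) n)) \<in> borel_measurable (past_algebra n)"
        unfolding past_algebra_def
        by (rule measurable_compose[OF measurable_vimage_algebra1 borel_measurable_past])
          (auto simp: space_PiM)
      moreover have "p g (past (?res x) n) = ?Q x" for x
        by (intro determined_byD[OF determined_by_past]) simp
      ultimately show ?thesis by simp
    qed
    have int: "integrable M ?I" "integrable M ?Q"
      by (auto intro!: integrable_const_bound[where B = 1] simp: nonneg kernel_le_one)
    \<comment> \<open>\<open>?D u\<close> is the measure with density \<open>u\<close>, seen on the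
      past only; equality for \<open>?I\<close> and \<open>?Q\<close> is the identity on all past
      events.\<close>
    let ?D = "\<lambda>u. distr (density M (\<lambda>x. ennreal (u x))) ?R ?res"
    have D: "emeasure (?D u) B = ennreal (\<integral>x. indicator (?res -` B) x * u x \<partial>M)"
      if [measurable]: "B \<in> sets ?R" "u \<in> borel_measurable M"
        and u: "\<And>x. 0 \<le> u x" "\<And>x. u x \<le> 1" for B and u :: "_ \<Rightarrow> real"
    proof -
      have B: "?res -` B \<in> sets M" using measurable_sets[OF res that(1)] by (simp add: space_M)
      have "emeasure (?D u) B = emeasure (density M (\<lambda>x. ennreal (u x))) (?res -` B)"
        by (subst emeasure_distr) (auto simp: space_M)
      also have "\<dots> = ennreal (\<integral>x. indicator (?res -` B) x * u x \<partial>M)"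
        using B u by (intro emeasure_density_indicator_integral) (auto intro: finite_measure_axioms)
      finally show ?thesis .
    qed
    have DI: "emeasure (?D ?I) B = ennreal (\<integral>x. indicator (?res -` B) x * ?I x \<partial>M)"
      and DQ: "emeasure (?D ?Q) B = ennreal (\<integral>x. indicator (?res -` B) x * ?Q x \<partial>M)"
      if "B \<in> sets ?R" for B
      using that by (auto intro!: D simp: nonneg kernel_le_one)
    have D_eq: "?D ?I = ?D ?Q"
    proof (rule measure_eqI_PiM_infinite)
      fix A :: "int \<Rightarrow> 'g set" and J assume J: "finite J" "J \<subseteq> {..<n}"
      let ?B = "prod_emb {..<n} (\<lambda>_. count_space UNIV) J (PiE J A)"
      have B: "?B \<in> sets ?R" using J by (intro sets_PiM_I) auto
      have "?res -` ?B = {x. \<forall>j\<in>J. x j \<in> A j}"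
        using J by (auto simp: prod_emb_def space_PiM PiE_def Pi_iff subset_eq)
      then have "determined_by J (indicator (?res -` ?B) :: _ \<Rightarrow> real)"
        by (auto simp: determined_by_def indicator_def)
      then have "(\<integral>x. indicator (?res -` ?B) x * ?I x \<partial>M) = (\<integral>x. indicator (?res -` ?B) x * ?Q x \<partial>M)"
        by (rule eq[OF J]) (simp add: indicator_def)
      then show "emeasure (?D ?I) ?B = emeasure (?D ?Q) ?B"
        by (simp only: DI[OF B] DQ[OF B])
    next
      show "finite_measure (?D ?I)"
        using DI[of "space ?R"] by (intro finite_measureI) auto
    qed simp_all
    have "(\<integral>x\<in>C. ?I x \<partial>M) = (\<integral>x\<in>C. ?Q x \<partial>M)" if "C \<in> sets (past_algebra n)" for C
    proof -
      obtain B where B: "B \<in> sets ?R" and C: "C = ?res -` B"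
        using \<open>C \<in> sets (past_algebra n)\<close> unfolding past_sets by blast
      have "ennreal (\<integral>x. indicator C x * ?I x \<partial>M) = ennreal (\<integral>x. indicator C x * ?Q x \<partial>M)"
        using DI[OF B] DQ[OF B] unfolding C D_eq by simp
      then show ?thesis
        by (simp add: set_lebesgue_integral_def ennreal_inj nonneg)
    qed
    from real_cond_exp_charact[OF this int Q_past]
    show ?thesis by (simp add: space_M indicator_def[abs_def])
  qed
  with M show ?thesis unfolding compatible_def past_def by blast
qed

text \<open>Every run respects \<Phi> surely, and respecting it at time \<open>n\<close> is a
  cylinder event, so its probability 1 passes to the weak limit.\<close>

lemma compatible_law_exists:
  assumes z: "\<And>n. z n \<in> \<Phi> n"
    and inv: "\<And>n w g. (\<And>k. k \<ge> 1 \<Longrightarrow> w k \<in> \<Phi> (n - int k)) \<Longrightarrow> p g w > 0 \<Longrightarrow> g \<in> \<Phi> n"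
  obtains M where "compatible p M" "AE x in M. x n \<in> \<Phi> n"
proof -
  obtain M r where r: "strict_mono (r :: nat \<Rightarrow> nat)" and M: "prob_space M"
    "sets M = sets (PiM UNIV (\<lambda>_. count_space UNIV))"
    and lim: "\<And>J (f :: _ \<Rightarrow> real). finite J \<Longrightarrow> determined_by J f \<Longrightarrow>
       (\<lambda>N. measure_pmf.expectation (run z (- int (r N)) (2 * r N)) f) \<longlonglongrightarrow> integral\<^sup>L M f"
    \<comment> \<open>Run number \<open>N\<close> draws the times from \<open>- N\<close> to
      \<open>N - 1\<close>, a window that exhausts the integers.\<close>
    by (rule pmf_weak_limit[of "\<lambda>N. run z (- int N) (2 * N)"]) blast
  have M': "sets M = sets path_space" using M(2) by (simp add: path_space_def)
  interpret prob_space M by fact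
  have space_M: "space M = UNIV"
    using sets_eq_imp_space_eq[OF M(2)] by (simp add: space_PiM)
  show thesis
  proof
    show "compatible p M"
      by (rule compatibleI[OF M(1) M'], rule integral_kernel_limit[OF M(1) M' r lim]) auto
    let ?f = "indicator {x. x n \<in> \<Phi> n} :: _ \<Rightarrow> real"
    have det: "determined_by {n} ?f" by (auto simp: determined_by_def indicator_def)
    have in_\<Phi>: "x n \<in> \<Phi> n" if "x \<in> set_pmf (run z s t)" for x s t
      by (rule run_invariant[where \<Phi> = \<Phi>]) (fact z, fact inv, fact that)
    have "measure_pmf.expectation (run z s t) ?f = 1" for s t
    proof -
      have "measure_pmf.expectation (run z s t) ?f = measure_pmf.expectation (run z s t) (\<lambda>_. 1)"
        using in_\<Phi> by (intro integral_cong_AE) (auto simp: AE_measure_pmf_iff)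
      then show ?thesis by simp
    qed
    with lim[OF _ det] have "integral\<^sup>L M ?f = 1" by (simp add: LIMSEQ_const_iff)
    moreover have "?f \<in> borel_measurable M"
      using borel_measurable_determined_by[OF _ _ det, of UNIV] M(2)
      by (simp cong: measurable_cong_sets)
    then have "{x. x n \<in> \<Phi> n} \<in> sets M"
      by (simp add: borel_measurable_indicator_iff space_M)
    ultimately show "AE x in M. x n \<in> \<Phi> n"
      using prob_Collect_eq_1[of "\<lambda>x. x n \<in> \<Phi> n"] by (simp add: space_M)
  qed
qed

end

subsection \<open>Periodic families of matrices\<close>

lemma word_mat_nonneg:
  assumes "\<forall>k\<in>A. stochastic_matrix (P k)" "set as \<subseteq> A"
  shows "0 \<le> word_mat P as i j"
  using assms(2)
proof (induction as arbitrary: i j)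
  case (Cons a as)
  then have "0 \<le> P a i j" for i j
    using assms(1) by (auto simp: stochastic_matrix_def)
  with Cons show ?case by (auto simp: mat_mult_def intro!: sum_nonneg mult_nonneg_nonneg)
qed simp

lemma mat_mult_pos:
  assumes "\<And>i j. 0 \<le> M i j" "\<And>i j. 0 \<le> N i j" "0 < M i l" "0 < N l j"
  shows "0 < mat_mult M N i j"
  unfolding mat_mult_def using assms
  by (intro sum_pos2[of _ l] mult_pos_pos mult_nonneg_nonneg) auto

lemma mat_mult_assoc: "mat_mult (mat_mult L M) N = mat_mult L (mat_mult M N)"
proof (intro ext)
  fix i j
  have "mat_mult (mat_mult L M) N i j = (\<Sum>l\<in>UNIV. \<Sum>h\<in>UNIV. L i h * M h l * N l j)"
    by (simp add: mat_mult_def sum_distrib_right)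
  also have "\<dots> = (\<Sum>h\<in>UNIV. \<Sum>l\<in>UNIV. L i h * M h l * N l j)"
    by (rule sum.swap)
  finally show "mat_mult (mat_mult L M) N i j = mat_mult L (mat_mult M N) i j"
    by (simp add: mat_mult_def sum_distrib_left mult.assoc)
qed

text \<open>The first letter of a word is the rightmost factor of its matrix, hence the reversed
  order.\<close>

lemma word_mat_append: "word_mat P (as @ bs) = mat_mult (word_mat P bs) (word_mat P as)"
proof (induction as)
  case Nil
  show ?case
    by (simp add: mat_mult_def fun_eq_iff if_distrib cong: if_cong)
next
  case (Cons a as)
  then show ?case by (simp add: mat_mult_assoc)
qed

lemma word_mat_single: "word_mat P [a] = P a"
  by (simp add: mat_mult_def fun_eq_iff if_distrib[of "\<lambda>x. x * _"] cong: if_cong)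

text \<open>Concatenation of paths; because of the reversal, \<open>bs\<close> is traversed before
  \<open>as\<close>.\<close>

lemma word_mat_append_pos:
  assumes "\<forall>k\<in>A. stochastic_matrix (P k)" "set as \<subseteq> A" "set bs \<subseteq> A"
    and "word_mat P bs i l > 0" "word_mat P as l j > 0"
  shows "word_mat P (as @ bs) i j > 0"
  unfolding word_mat_append using assms
  by (intro mat_mult_pos word_mat_nonneg[of A P]) auto

section \<open>Phases modulo the period\<close>

lemma period_dvd_depth:
  assumes "as \<in> words A" "word_mat P as i i > 0"
  shows "period A P i dvd depth as"
  unfolding period_def using assms by (intro Gcd_dvd) auto

text \<open>The phase of \<open>j\<close> is the depth of a chosen word from a base point to
  \<open>j\<close>. Different routes to \<open>j\<close>, closed up by the same return word, become
  loops whose depths are multiples of \<open>d\<close>.\<close>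

lemma ex_phase_function:
  fixes P :: "nat \<Rightarrow> 'g::finite \<Rightarrow> 'g \<Rightarrow> real"
  assumes P: "\<forall>k\<in>A. stochastic_matrix (P k)" and irred: "irreducible_fam A P"
    and period: "\<forall>i. period A P i = d"
  obtains c :: "'g \<Rightarrow> int" where
    "\<And>k i j. k \<in> A \<Longrightarrow> P k i j > 0 \<Longrightarrow> [c j = c i + int k] (mod int d)"
proof -
  \<comment> \<open>Any base point would do.\<close>
  define i0 :: 'g where "i0 = undefined"
  have "\<forall>i j. \<exists>as. as \<in> words A \<and> word_mat P as i j > 0"
    using irred unfolding irreducible_fam_def by blast
  then obtain W where W: "\<And>i j. W i j \<in> words A" "\<And>i j. word_mat P (W i j) i j > 0"
    by metis
  define c where "c j = int (depth (W i0 j))" for j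
  have sub: "set (W i j) \<subseteq> A" and ne: "W i j \<noteq> []" for i j
    using W(1)[of i j] by (auto simp: words_def)
  have loop: "d dvd depth as" if "set as \<subseteq> A" "as \<noteq> []" "word_mat P as i0 i0 > 0" for as
    using period_dvd_depth[of as A P i0] period that by (simp add: words_def)
  have "[c j = c i + int k] (mod int d)" if k: "k \<in> A" and pos: "P k i j > 0" for k i j
  proof -
    have single: "set [k] \<subseteq> A" "word_mat P [k] i j > 0"
      using k pos word_mat_single[of P k] by simp_all
    \<comment> \<open>Two loops with the common return word \<open>W j i0\<close>: one goes out to
      \<open>j\<close> directly, the other via \<open>i\<close> and the transition \<open>k\<close>.
      Their depths differ by \<open>c j - c i - k\<close>.\<close>
    have "word_mat P (W j i0 @ W i0 j) i0 i0 > 0"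
      by (rule word_mat_append_pos[OF P sub sub W(2) W(2)])
    then have 1: "d dvd depth (W j i0 @ W i0 j)"
      by (intro loop) (simp_all add: sub ne)
    have "word_mat P ([k] @ W i0 i) i0 j > 0"
      by (rule word_mat_append_pos[OF P single(1) sub W(2) single(2)])
    moreover have "set ([k] @ W i0 i) \<subseteq> A" using k sub[of i0 i] by simp
    ultimately have "word_mat P (W j i0 @ ([k] @ W i0 i)) i0 i0 > 0"
      by (intro word_mat_append_pos[OF P sub _ _ W(2)])
    then have 2: "d dvd depth (W j i0 @ ([k] @ W i0 i))"
      by (rule loop[rotated 2]) (simp_all add: sub ne k)
    from 1 2 have "int d dvd int (depth (W j i0 @ W i0 j)) - int (depth (W j i0 @ ([k] @ W i0 i)))"
      by (intro dvd_diff) (simp_all only: int_dvd_int_iff)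
    then show ?thesis
      by (simp add: cong_iff_dvd_diff c_def depth_def algebra_simps)
  qed
  then show thesis by (rule that)
qed

text \<open>\<open>S\<close> is a subgroup of the integers. Division with remainder shows that its
  least positive element divides all of \<open>A\<close>, hence equals 1.\<close>

lemma int_subgroup_Gcd_one:
  fixes S :: "int set"
  assumes "0 \<in> S" and diff: "\<And>x y. x \<in> S \<Longrightarrow> y \<in> S \<Longrightarrow> x - y \<in> S"
    and A: "int ` A \<subseteq> S" "Gcd A = 1"
  shows "S = UNIV"
proof -
  have neg: "- x \<in> S" if "x \<in> S" for x using diff[OF assms(1) that] by simp
  have add: "x + y \<in> S" if "x \<in> S" "y \<in> S" for x y
    using diff[OF that(1) neg[OF that(2)]] by simp
  have mult_nat: "int m * x \<in> S" if "x \<in> S" for m x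
    by (induction m) (auto simp: assms(1) algebra_simps that intro: add)
  have mult: "m * x \<in> S" if "x \<in> S" for m x
    using mult_nat[OF that, of "nat m"] neg[OF mult_nat[OF that, of "nat (- m)"]]
    by (cases "m \<ge> 0") auto
  \<comment> \<open>This makes the least positive element exist; both the empty set and
    \<open>{0}\<close> have \<open>Gcd\<close> 0.\<close>
  have "\<exists>k\<in>A. k > 0"
  proof (rule ccontr)
    assume "\<not> ?thesis"
    then have "A \<subseteq> {0}" by auto
    then have "Gcd A = 0" by (metis Gcd_0_iff)
    with A show False by simp
  qed
  then have ex: "\<exists>e. e > 0 \<and> int e \<in> S" using A by blast
  define e where "e = (LEAST e. e > 0 \<and> int e \<in> S)"
  have e: "e > 0" "int e \<in> S" using LeastI_ex[OF ex] by (auto simp: e_def)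
  have "e dvd k" if "k \<in> A" for k
  proof (rule ccontr)
    assume "\<not> e dvd k"
    then have "k mod e > 0" by (simp add: mod_greater_zero_iff_not_dvd)
    moreover have "int k - int (k div e) * int e \<in> S"
      using A that by (intro diff mult e) auto
    then have "int (k mod e) \<in> S"
      by (simp add: minus_div_mult_eq_mod zmod_int zdiv_int)
    ultimately have "e \<le> k mod e" unfolding e_def by (intro Least_le) simp
    with e show False by (meson mod_less_divisor not_less)
  qed
  then have "e dvd Gcd A" by (rule Gcd_greatest)
  with A e mult[OF e(2)] show ?thesis by auto
qed

text \<open>The shifts \<open>S\<close> by which the phase can be raised from every state form a
  subgroup. It contains \<open>A\<close>, since each row of a stochastic matrix has a positive
  entry, so it is everything.\<close>

lemma phase_function_surj:
  fixes c :: "'g::finite \<Rightarrow> int" and P :: "nat \<Rightarrow> 'g \<Rightarrow> 'g \<Rightarrow> real"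
  assumes P: "\<forall>k\<in>A. stochastic_matrix (P k)" and gcd_A: "Gcd A = 1" and d: "d > 0"
    and c: "\<And>k i j. k \<in> A \<Longrightarrow> P k i j > 0 \<Longrightarrow> [c j = c i + int k] (mod int d)"
  shows "\<exists>j. [c j = m] (mod int d)"
proof -
  define S where "S = {s. \<forall>i. \<exists>j. [c j = c i + s] (mod int d)}"
  have S_add: "x + y \<in> S" if x: "x \<in> S" and y: "y \<in> S" for x y
    unfolding S_def
  proof (intro CollectI allI)
    fix i
    obtain j where j: "[c j = c i + x] (mod int d)" using x unfolding S_def by blast
    obtain h where h: "[c h = c j + y] (mod int d)" using y unfolding S_def by blast
    have "[c h = (c i + x) + y] (mod int d)"
      by (rule cong_trans[OF h cong_add[OF j cong_refl]])
    then show "\<exists>h. [c h = c i + (x + y)] (mod int d)" by (auto simp: add.assoc)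
  qed
  have zero: "0 \<in> S" by (auto simp: S_def intro: cong_refl)
  have S_mult: "int k * x \<in> S" if "x \<in> S" for k x
    by (induction k) (simp_all add: zero distrib_right that S_add)
  have S_cong: "y \<in> S" if x: "x \<in> S" and xy: "[x = y] (mod int d)" for x y
    using x unfolding S_def by (blast intro: cong_trans cong_add[OF cong_refl xy])
  \<comment> \<open>Modulo \<open>d\<close>, subtracting \<open>x\<close> is the same as adding it
    \<open>d - 1\<close> times.\<close>
  have S_neg: "- x \<in> S" if "x \<in> S" for x
  proof (rule S_cong[OF S_mult[OF that, of "d - 1"]])
    show "[int (d - 1) * x = - x] (mod int d)"
      using d by (simp add: cong_iff_dvd_diff of_nat_diff algebra_simps)
  qed
  have "int k \<in> S" if k: "k \<in> A" for k
    unfolding S_def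
  proof (intro CollectI allI)
    fix i
    have "(\<Sum>j\<in>UNIV. P k i j) = 1" "\<forall>j. P k i j \<ge> 0"
      using P k by (auto simp: stochastic_matrix_def)
    then obtain j where "P k i j > 0"
      by (metis less_eq_real_def sum.neutral zero_neq_one)
    from c[OF k this] show "\<exists>j. [c j = c i + int k] (mod int d)" ..
  qed
  moreover have "x - y \<in> S" if "x \<in> S" "y \<in> S" for x y
    using S_add[OF that(1) S_neg[OF that(2)]] by simp
  ultimately have "S = UNIV"
    by (intro int_subgroup_Gcd_one[OF zero _ _ gcd_A]) auto
  then have "m - c undefined \<in> S" by simp
  then have "\<exists>j. [c j = c undefined + (m - c undefined)] (mod int d)"
    unfolding S_def by blast
  then show ?thesis by simp
qed

section \<open>Imitation kernels as continuous kernels\<close>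

lemma imitation_kernel_has_sum:
  assumes \<theta>: "\<forall>k\<in>A. \<theta> k > 0" "(\<theta> has_sum 1) A" and P: "\<forall>k\<in>A. stochastic_matrix (P k)"
  shows "((\<lambda>k. \<theta> k * P k (w k) g) has_sum imitation_kernel A \<theta> P g w) A"
    (is "(?f has_sum _) A")
proof -
  have bounds: "0 \<le> ?f k" "?f k \<le> \<theta> k" if "k \<in> A" for k
  proof -
    have "0 \<le> P k (w k) j" "(\<Sum>j\<in>UNIV. P k (w k) j) = 1" for j
      using P that by (auto simp: stochastic_matrix_def)
    then have "0 \<le> P k (w k) g" "P k (w k) g \<le> 1"
      using member_le_sum[of g UNIV "P k (w k)"] by auto
    moreover have "0 \<le> \<theta> k" using \<theta>(1) that by (simp add: less_imp_le)
    ultimately show "0 \<le> ?f k" "?f k \<le> \<theta> k" by (auto intro: mult_left_le)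
  qed
  have "\<theta> summable_on A" using \<theta>(2) by (auto simp: summable_on_def)
  \<comment> \<open>Domination by \<theta> ensures that the \<open>infsum\<close> in the kernel is a
    genuine sum and not its default value 0.\<close>
  then have "?f summable_on A"
    by (rule summable_on_comparison_test) (auto simp: bounds)
  then show ?thesis unfolding imitation_kernel_def by (rule has_sum_infsum)
qed

lemma has_sum_finite_sum:
  fixes f :: "'b \<Rightarrow> 'a \<Rightarrow> 'c::topological_comm_monoid_add"
  assumes "finite B" "\<And>b. b \<in> B \<Longrightarrow> (f b has_sum s b) A"
  shows "((\<lambda>x. \<Sum>b\<in>B. f b x) has_sum (\<Sum>b\<in>B. s b)) A"
  using assms
proof (induction B rule: finite_induct)
  case (insert b B)
  have "((\<lambda>x. f b x + (\<Sum>b\<in>B. f b x)) has_sum (s b + (\<Sum>b\<in>B. s b))) A"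
    by (rule has_sum_add) (simp_all add: insert.IH insert.prems)
  then show ?case by (simp add: insert.hyps)
qed simp

text \<open>A finite set carrying the sum up to \<epsilon> lies below some \<open>m\<close>; all
  indices beyond \<open>m\<close> belong to the rest.\<close>

lemma has_sum_tail_le:
  fixes \<theta> :: "nat \<Rightarrow> real"
  assumes "(\<theta> has_sum s) A" "\<And>k. k \<in> A \<Longrightarrow> \<theta> k \<ge> 0" "\<epsilon> > 0"
  obtains m where "infsum \<theta> (A \<inter> {m<..}) < \<epsilon>"
proof -
  obtain F where F: "finite F" "F \<subseteq> A" "dist (sum \<theta> F) s < \<epsilon>"
    using has_sum_finite_approximation[OF assms(1), of "\<epsilon> / 2"] assms(3) by force
  obtain m where m: "\<And>k. k \<in> F \<Longrightarrow> k \<le> m"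
    using F(1) finite_nat_set_iff_bounded_le by auto
  have summable: "\<theta> summable_on A" using assms(1) by (auto simp: summable_on_def)
  have "infsum \<theta> (A \<inter> {m<..}) \<le> infsum \<theta> (A - F)"
    using assms(2) m by (intro infsum_mono_neutral summable_on_subset_banach[OF summable]) (force dest: m)+
  also have "infsum \<theta> (A - F) = infsum \<theta> A - infsum \<theta> F"
    using F by (intro infsum_Diff summable) (auto intro: summable_on_finite)
  also have "\<dots> = s - sum \<theta> F" using F infsumI[OF assms(1)] by simp
  also have "\<dots> < \<epsilon>" using F(3) by (simp add: dist_real_def)
  finally show thesis by (rule that)
qed

text \<open>Pasts that agree up to lag \<open>m\<close> give the same terms there, and each later
  term changes by at most \<theta> at its lag. The tail of \<theta> therefore bounds the
  difference.\<close>

lemma continuous_kernel_imitation_kernel: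
  fixes P :: "nat \<Rightarrow> 'g::finite \<Rightarrow> 'g \<Rightarrow> real"
  assumes A: "A \<subseteq> {1..}" and \<theta>: "\<forall>k\<in>A. \<theta> k > 0" "(\<theta> has_sum 1) A"
    and P: "\<forall>k\<in>A. stochastic_matrix (P k)"
  shows "continuous_kernel (imitation_kernel A \<theta> P)"
proof (rule continuous_kernel.intro)
  note sums = imitation_kernel_has_sum[OF \<theta> P]
  have P_nonneg: "0 \<le> P k i j" and P_le: "P k i j \<le> 1" and P_sum: "(\<Sum>j\<in>UNIV. P k i j) = 1"
    if "k \<in> A" for k i j
  proof -
    have "0 \<le> P k i j" "(\<Sum>j\<in>UNIV. P k i j) = 1" for j
      using P that by (auto simp: stochastic_matrix_def)
    then show "0 \<le> P k i j" "P k i j \<le> 1" "(\<Sum>j\<in>UNIV. P k i j) = 1"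
      using member_le_sum[of j UNIV "P k i"] by auto
  qed
  have \<theta>_nonneg: "0 \<le> \<theta> k" if "k \<in> A" for k
    using \<theta>(1) that by (simp add: less_imp_le)
  show "0 \<le> imitation_kernel A \<theta> P g w" for g w
    by (rule has_sum_nonneg[OF sums]) (simp add: \<theta>_nonneg P_nonneg)
  show "(\<Sum>g\<in>UNIV. imitation_kernel A \<theta> P g w) = 1" for w
  proof -
    have "((\<lambda>k. \<Sum>g\<in>UNIV. \<theta> k * P k (w k) g) has_sum (\<Sum>g\<in>UNIV. imitation_kernel A \<theta> P g w)) A"
      by (rule has_sum_finite_sum[OF finite sums])
    moreover have "(\<Sum>g\<in>UNIV. \<theta> k * P k (w k) g) = \<theta> k" if "k \<in> A" for k
      using P_sum[OF that, of "w k"] by (metis sum_distrib_left mult.right_neutral)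
    then have "((\<lambda>k. \<Sum>g\<in>UNIV. \<theta> k * P k (w k) g) has_sum s) A \<longleftrightarrow> (\<theta> has_sum s) A" for s
      by (rule has_sum_cong)
    ultimately have "(\<theta> has_sum (\<Sum>g\<in>UNIV. imitation_kernel A \<theta> P g w)) A"
      by blast
    then show ?thesis using \<theta>(2) by (rule has_sum_unique)
  qed
  show "\<exists>m. \<forall>g w w'. (\<forall>k\<in>{1..m}. w k = w' k) \<longrightarrow>
      \<bar>imitation_kernel A \<theta> P g w - imitation_kernel A \<theta> P g w'\<bar> < \<epsilon>" if \<epsilon>: "\<epsilon> > 0" for \<epsilon>
  proof -
    obtain m where m: "infsum \<theta> (A \<inter> {m<..}) < \<epsilon>"
      by (rule has_sum_tail_le[OF \<theta>(2) \<theta>_nonneg \<epsilon>])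
    have "\<theta> summable_on (A \<inter> {m<..})"
      by (rule summable_on_subset_banach[OF has_sum_imp_summable[OF \<theta>(2)]]) simp
    then have tail: "(\<theta> has_sum infsum \<theta> (A \<inter> {m<..})) (A \<inter> {m<..})" by (rule has_sum_infsum)
    \<comment> \<open>One-sided; exchanging \<open>w\<close> and \<open>w'\<close> yields the
      absolute value.\<close>
    have le: "imitation_kernel A \<theta> P g w - imitation_kernel A \<theta> P g w' \<le> infsum \<theta> (A \<inter> {m<..})"
      if agree: "\<forall>k\<in>{1..m}. w k = w' k" for g w w'
    proof -
      have "((\<lambda>k. \<theta> k * P k (w k) g - \<theta> k * P k (w' k) g) has_sum
          imitation_kernel A \<theta> P g w - imitation_kernel A \<theta> P g w') A"
        unfolding diff_conv_add_uminus by (intro has_sum_add sums iffD2[OF has_sum_uminus]) (simp add: sums)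
      then show ?thesis
      proof (rule has_sum_mono_neutral[OF _ tail])
        fix k assume k: "k \<in> A \<inter> (A \<inter> {m<..})"
        then have "P k (w k) g - P k (w' k) g \<le> 1" 
          using P_le[of k "w k" g] P_nonneg[of k "w' k" g] by simp
        with k have "\<theta> k * (P k (w k) g - P k (w' k) g) \<le> \<theta> k"
          by (intro mult_left_le \<theta>_nonneg) auto
        then show "\<theta> k * P k (w k) g - \<theta> k * P k (w' k) g \<le> \<theta> k"
          by (simp add: algebra_simps)
      next
        fix k assume "k \<in> A - A \<inter> {m<..}"
        with A have "k \<in> {1..m}" by auto
        with agree have "w k = w' k" by blast
        then show "\<theta> k * P k (w k) g - \<theta> k * P k (w' k) g \<le> 0" by simp
      qed auto
    qed
    show ?thesis
    proof (intro exI[of _ m] allI impI)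
      fix g and w w' :: "nat \<Rightarrow> 'g" assume agree: "\<forall>k\<in>{1..m}. w k = w' k"
      then have "\<forall>k\<in>{1..m}. w' k = w k" by (intro ballI) (rule sym, blast)
      from le[OF agree, where g = g] le[OF this, where g = g] m
      show "\<bar>imitation_kernel A \<theta> P g w - imitation_kernel A \<theta> P g w'\<bar> < \<epsilon>" by linarith
    qed
  qed
qed

lemma imitation_kernel_posD:
  assumes "imitation_kernel A \<theta> P g w > 0" "\<forall>k\<in>A. stochastic_matrix (P k)"
  obtains k where "k \<in> A" "P k (w k) g > 0"
proof -
  have "\<exists>k\<in>A. \<theta> k * P k (w k) g \<noteq> 0"
  proof (rule ccontr)
    assume "\<not> ?thesis"
    then have "imitation_kernel A \<theta> P g w = 0"
      unfolding imitation_kernel_def by (intro infsum_0) blast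
    with assms(1) show False by simp
  qed
  then obtain k where k: "k \<in> A" "P k (w k) g \<noteq> 0" by auto
  moreover have "P k (w k) g \<ge> 0"
    using assms(2) k(1) by (simp add: stochastic_matrix_def)
  ultimately show thesis by (intro that[of k]) auto
qed

section \<open>Two compatible laws with different phase offsets\<close>

theorem mainTheorem5:
  fixes A :: "nat set" and \<theta> :: "nat \<Rightarrow> real"
    and P :: "nat \<Rightarrow> 'g::finite \<Rightarrow> 'g \<Rightarrow> real" and d :: nat
  assumes A_pos: "A \<subseteq> {1..}"
    and theta_pos: "\<forall>k\<in>A. \<theta> k > 0"
    and theta_prob: "(\<theta> has_sum 1) A"
    and P_stoch: "\<forall>k\<in>A. stochastic_matrix (P k)"
    and gcd_A: "Gcd A = 1"
    and irred: "irreducible_fam A P"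
    and common_period: "\<forall>i. period A P i = d"
    and d_gt: "d > 1"
  shows "\<exists>M1\<in>compatible_laws (imitation_kernel A \<theta> P).
         \<exists>M2\<in>compatible_laws (imitation_kernel A \<theta> P). M1 \<noteq> M2"
proof -
  obtain c :: "'g \<Rightarrow> int" where
    c: "\<And>k i j. k \<in> A \<Longrightarrow> P k i j > 0 \<Longrightarrow> [c j = c i + int k] (mod int d)"
    using ex_phase_function[OF P_stoch irred common_period] by blast
  \<comment> \<open>The letters allowed at time \<open>n\<close> on paths of offset
    \<open>r\<close>.\<close>
  define \<Phi> where "\<Phi> r n = {j. [c j = n + r] (mod int d)}" for r n
  have "\<forall>r n. \<exists>j. j \<in> \<Phi> r n"
    using phase_function_surj[OF P_stoch gcd_A _ c] d_gt unfolding \<Phi>_def by auto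
  then obtain z where z: "\<And>r n. z r n \<in> \<Phi> r n" by metis
  have inv: "g \<in> \<Phi> r n"
    if w: "\<And>k. k \<ge> 1 \<Longrightarrow> w k \<in> \<Phi> r (n - int k)" and pos: "imitation_kernel A \<theta> P g w > 0"
    for r n w g
  proof -
    \<comment> \<open>A letter of positive probability is reached from some \<open>w k\<close> by a
      transition of \<open>P k\<close>. The phase \<open>n - k + r\<close> of \<open>w k\<close>
      rises by \<open>k\<close>, so the offset is kept.\<close>
    obtain k where k: "k \<in> A" "P k (w k) g > 0"
      using imitation_kernel_posD[OF pos P_stoch] by blast
    with A_pos w have "[c (w k) = n - int k + r] (mod int d)" by (auto simp: \<Phi>_def)
    from cong_trans[OF c[OF k] cong_add[OF this cong_refl]]
    show ?thesis by (simp add: \<Phi>_def)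
  qed
  interpret continuous_kernel "imitation_kernel A \<theta> P"
    by (rule continuous_kernel_imitation_kernel[OF A_pos theta_pos theta_prob P_stoch])
  have "\<exists>M. compatible (imitation_kernel A \<theta> P) M \<and> (AE x in M. x 0 \<in> \<Phi> r 0)" for r
    by (rule compatible_law_exists[where z = "z r" and \<Phi> = "\<Phi> r"]) (fact z, fact inv, blast)
  then obtain M where M: "\<And>r. compatible (imitation_kernel A \<theta> P) (M r)"
    and AE_M: "\<And>r. AE x in M r. x 0 \<in> \<Phi> r 0" by metis
  have "M 0 \<noteq> M 1"
  proof
    \<comment> \<open>The phase at time 0 would almost surely be congruent to both 0 and 1 modulo
      \<open>d\<close>, which \<open>d > 1\<close> forbids.\<close>
    assume eq: "M 0 = M 1"
    interpret prob_space "M 0" using M by (simp add: compatible_def)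
    have disjoint: False if "j \<in> \<Phi> 0 0" "j \<in> \<Phi> 1 0" for j
    proof -
      have "[0 = 1] (mod int d)"
        using that by (auto simp: \<Phi>_def intro: cong_trans cong_sym)
      with d_gt show False by (simp add: cong_def)
    qed
    have "AE x in M 0. False"
      using AE_M[of 0] AE_M[of 1, folded eq] by eventually_elim (rule disjoint)
    then show False by (simp add: AE_False)
  qed
  with M show ?thesis unfolding compatible_laws_def by blast
qed

end
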